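(* Let $N>2$ and let $G$ be an $N$-player partizan game. Then $0\le_L G$ if and only if either $G\cong 0$ or every option of $G$ is a Left option (no player other than Left has an option in $G$).
   Context: An $N$-player partizan game ($N\ge2$) is an ordered $N$-tuple $(\mathscr G^{C_0},\dots,\mathscr G^{C_{N-1}})$ of finite sets of partizan games (with no infinite runs); the players are Left $=C_0$, $\mathrm{Center}_1=C_1,\dots,\mathrm{Center}_{N-2}=C_{N-2}$, Right $=C_{N-1}$, who move cyclically (Left after Right), and $\mathscr G^{C_i}$ is the set of options available to $C_i$ when it is their turn. Under normal play, a player with no option on their turn is the unique loser and all other players win. $0$ is the game with no options; $\cong$ is isomorphism of game trees. The disjunctive sum $G+H$ has $C_i$-options $G^{C_i}+H$ and $G+H^{C_i}$. "Left has a winning strategy in $G$ moving $i$th" ($1\le i\le N$) means: with the first move made by the player for whom Left is the $i$th player to move, Left can guarantee not being the loser. Write $G\le_L H$ if for every game $X$ and every $1\le i\le N$, whenever Left has a winning strategy in $G+X$ moving $i$th, Left has a winning strategy in $H+X$ moving $i$th. *)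

theory Defs
  imports "HOL-Library.FSet"
begin

text \<open>
  Players are numbered \<open>0\<close> (Left), \<open>1, \<dots>, N - 2\<close> (the Centers), \<open>N - 1\<close> (Right).  A tuple of
  option sets is stored as a function on \<open>nat\<close>; for an \<open>N\<close>-player game all entries from
  index \<open>N\<close> on are empty, hereditarily (\<open>N_player\<close> below).  Absence of infinite runs is
  well-foundedness of the datatype.
\<close>

datatype game = Game (options: "nat \<Rightarrow> game fset")

inductive N_player :: "nat \<Rightarrow> game \<Rightarrow> bool" for N :: nat where
  "\<lbrakk>\<And>i. N \<le> i \<Longrightarrow> options G i = {||};
    \<And>i G'. i < N \<Longrightarrow> G' |\<in>| options G i \<Longrightarrow> N_player N G'\<rbrakk> \<Longrightarrow> N_player N G"

definition option_rel :: "(game \<times> game) set" where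
  "option_rel = {(G', G). \<exists>i. G' |\<in>| options G i}"

lemma wf_option_rel: "wf option_rel"
proof (rule wfUNIVI)
  fix P :: "game \<Rightarrow> bool" and G :: game
  assume step: "\<forall>x. (\<forall>y. (y, x) \<in> option_rel \<longrightarrow> P y) \<longrightarrow> P x"
  show "P G"
  proof (induction G)
    case (Game g)
    have "P y" if y: "(y, Game g) \<in> option_rel" for y
    proof -
      from y obtain i where "y |\<in>| g i"
        by (auto simp: option_rel_def)
      then show ?thesis
        using Game[of "g i" y] by simp
    qed
    then show ?case using step by blast
  qed
qed

instantiation game :: "{zero, plus}"
begin

definition zero_game :: game where
  "0 = Game (\<lambda>_. {||})"

function plus_game :: "game \<Rightarrow> game \<Rightarrow> game" where
  "G + H = Game (\<lambda>i. (\<lambda>G'. G' + H) |`| options G i |\<union>| (\<lambda>H'. G + H') |`| options H i)"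
  by pat_completeness auto
termination
proof (relation "option_rel <*lex*> option_rel")
  show "wf (option_rel <*lex*> option_rel)"
    by (intro wf_lex_prod wf_option_rel)
qed (auto simp: option_rel_def)

instance ..

end

declare plus_game.simps [simp del]

text \<open>Isomorphism of game trees, respecting which player owns each option.\<close>

inductive game_iso :: "game \<Rightarrow> game \<Rightarrow> bool"  (infix "\<cong>" 50) where
  "(\<And>i. \<exists>f. bij_betw f (fset (options G i)) (fset (options H i)) \<and>
             (\<forall>G' \<in> fset (options G i). G' \<cong> f G')) \<Longrightarrow> G \<cong> H"

text \<open>
  A (partial) run with first mover \<open>s\<close> is the nonempty list of positions visited so far, most
  recent position first.  Left's strategies may depend on the whole run; they are
  unconstrained where Left has no option.
\<close>

definition to_move :: "nat \<Rightarrow> nat \<Rightarrow> game list \<Rightarrow> nat" where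
  "to_move N s run = (s + (length run - 1)) mod N"

definition left_strategy :: "(game list \<Rightarrow> game) \<Rightarrow> bool" where
  "left_strategy \<sigma> \<longleftrightarrow>
     (\<forall>H past. options H 0 \<noteq> {||} \<longrightarrow> \<sigma> (H # past) |\<in>| options H 0)"

inductive run_with :: "nat \<Rightarrow> nat \<Rightarrow> (game list \<Rightarrow> game) \<Rightarrow> game \<Rightarrow> game list \<Rightarrow> bool"
  for N s :: nat and \<sigma> :: "game list \<Rightarrow> game" and G :: game where
  start: "run_with N s \<sigma> G [G]"
| left: "\<lbrakk>run_with N s \<sigma> G (H # past); to_move N s (H # past) = 0; options H 0 \<noteq> {||}\<rbrakk>
    \<Longrightarrow> run_with N s \<sigma> G (\<sigma> (H # past) # H # past)"
| other: "\<lbrakk>run_with N s \<sigma> G (H # past); to_move N s (H # past) \<noteq> 0;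
           H' |\<in>| options H (to_move N s (H # past))\<rbrakk>
    \<Longrightarrow> run_with N s \<sigma> G (H' # H # past)"

text \<open>Normal play: the player on turn without an option is the loser.\<close>

definition loser :: "nat \<Rightarrow> nat \<Rightarrow> game list \<Rightarrow> nat \<Rightarrow> bool" where
  "loser N s run i \<longleftrightarrow> to_move N s run = i \<and> options (hd run) i = {||}"

definition left_wins_from :: "nat \<Rightarrow> nat \<Rightarrow> game \<Rightarrow> bool" where
  "left_wins_from N s G \<longleftrightarrow>
     (\<exists>\<sigma>. left_strategy \<sigma> \<and> (\<forall>run. run_with N s \<sigma> G run \<longrightarrow> \<not> loser N s run 0))"

text \<open>
  Left moves \<open>i\<close>th iff the first mover \<open>s\<close> satisfies \<open>s + (i - 1) \<equiv> 0\<close> modulo \<open>N\<close>: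
  \<open>i = 1\<close> means that Left starts, \<open>i = 2\<close> that Right starts, \<open>i = N\<close> that player \<open>1\<close> starts.
\<close>

definition left_wins_moving :: "nat \<Rightarrow> nat \<Rightarrow> game \<Rightarrow> bool" where
  "left_wins_moving N i G \<longleftrightarrow> left_wins_from N ((N + 1 - i) mod N) G"

definition le_left :: "nat \<Rightarrow> game \<Rightarrow> game \<Rightarrow> bool" where
  "le_left N G H \<longleftrightarrow>
     (\<forall>X. N_player N X \<longrightarrow>
        (\<forall>i \<in> {1..N}. left_wins_moving N i (G + X) \<longrightarrow> left_wins_moving N i (H + X)))"

end

theory Submission
  imports Defs
begin

text \<open>
  If only Left can move in \<open>G\<close>, Left may ignore \<open>G\<close> altogether and follow a winning strategy
  in \<open>X\<close>.  Conversely, let a player \<open>j\<close> other than Left have an option \<open>G'\<close> in \<open>G\<close>.  Take for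
  \<open>X\<close> the game in which neither Left nor \<open>j\<close> can move, while everybody else may move to a long
  reserve of moves shared by all players but Left.  With \<open>j\<close> starting, \<open>j\<close> loses \<open>X\<close> at once.
  In \<open>G + X\<close>, however, \<open>j\<close> moves to \<open>G' + X\<close>, and since there is a third player, the reserve is
  opened before \<open>j\<close> is on turn again.  From then on Left alone has to live on the moves of
  \<open>G'\<close> and runs out of them first.
\<close>

lemma options_plus:
  "options (G + H) i = (\<lambda>G'. G' + H) |`| options G i |\<union>| (\<lambda>H'. G + H') |`| options H i"
  by (subst plus_game.simps) simp

lemma N_player_option: "\<lbrakk>N_player N G; i < N; G' |\<in>| options G i\<rbrakk> \<Longrightarrow> N_player N G'"
  by (auto elim: N_player.cases)

lemma options_zero [simp]: "options 0 i = {||}"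
  by (simp add: zero_game_def)

lemma zero_plus_game [simp]: "(0::game) + X = X"
proof (induction X)
  case (Game g)
  have "0 + x = x" if "x |\<in>| g i" for x i
    using Game[of "g i" x] that by simp
  then have "(\<lambda>H'. 0 + H') |`| g i = g i" for i
    by (force simp: image_iff)
  then show ?case
    by (subst plus_game.simps) simp
qed

lemma game_iso_zero: "G \<cong> 0 \<Longrightarrow> options G i = {||}"
  by (erule game_iso.cases) (metis bij_betw_empty2 bot_fset.rep_eq fset_inject options_zero)

text \<open>Backward-induction form of Left's win with player \<open>p\<close> on turn, free of runs
  and histories. The base case is \<open>other\<close> at a position where \<open>p\<close> has no
  option and so loses; a least fixed point suffices because play always ends.\<close>

inductive lwin :: "nat \<Rightarrow> nat \<Rightarrow> game \<Rightarrow> bool" for N :: nat where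
  left: "\<lbrakk>H |\<in>| options G 0; lwin N (Suc 0 mod N) H\<rbrakk> \<Longrightarrow> lwin N 0 G"
| other: "\<lbrakk>p \<noteq> 0; \<And>H. H |\<in>| options G p \<Longrightarrow> lwin N (Suc p mod N) H\<rbrakk> \<Longrightarrow> lwin N p G"

lemma lwin_0D: "lwin N 0 G \<Longrightarrow> \<exists>H. H |\<in>| options G 0 \<and> lwin N (Suc 0 mod N) H"
  by (erule lwin.cases) blast+

lemma lwin_otherD:
  "\<lbrakk>lwin N p G; p \<noteq> 0; H |\<in>| options G p\<rbrakk> \<Longrightarrow> lwin N (Suc p mod N) H"
  by (auto elim: lwin.cases)

lemma to_move_Cons: "to_move N s (H' # H # past) = Suc (to_move N s (H # past)) mod N"
  by (simp add: to_move_def mod_Suc_eq)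

text \<open>Well-founded induction on the current position; the past stays arbitrary because
  \<open>\<sigma>\<close> may depend on the whole run.\<close>

lemma lwin_if_never_loser:
  assumes "\<And>run. run_with N s \<sigma> G run \<Longrightarrow> \<not> loser N s run 0"
    and "left_strategy \<sigma>" and "run_with N s \<sigma> G (H # past)"
  shows "lwin N (to_move N s (H # past)) H"
  using wf_option_rel assms(3)
proof (induction H arbitrary: past rule: wf_induct_rule)
  case (less H)
  show ?case
  proof (cases "to_move N s (H # past) = 0")
    case True
    with assms(1) less.prems have ne: "options H 0 \<noteq> {||}"
      by (fastforce simp: loser_def)
    with assms(2) have opt: "\<sigma> (H # past) |\<in>| options H 0"
      by (simp add: left_strategy_def)
    have "lwin N (to_move N s (\<sigma> (H # past) # H # past)) (\<sigma> (H # past))"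
      using less.prems True ne opt by (intro less.IH run_with.left) (auto simp: option_rel_def)
    then show ?thesis
      using True opt lwin.left by (simp add: to_move_Cons)
  next
    case False
    have step: "lwin N (to_move N s (H' # H # past)) H'"
      if "H' |\<in>| options H (to_move N s (H # past))" for H'
      using less.prems False that by (intro less.IH run_with.other) (auto simp: option_rel_def)
    show ?thesis
      by (rule lwin.other) (use step False in \<open>simp_all add: to_move_Cons\<close>)
  qed
qed

lemma left_wins_from_if_lwin:
  assumes "lwin N (s mod N) G"
  shows "left_wins_from N s G"
proof -
  define good where "good H H' \<longleftrightarrow> H' |\<in>| options H 0 \<and> lwin N (Suc 0 mod N) H'" for H H'
  \<comment> \<open>\<open>\<sigma>\<close> picks an option that preserves \<open>lwin\<close>. The
    fallback keeps it legal where no such option exists, since \<open>left_strategy\<close>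
    constrains it at every position.\<close>
  define \<sigma> where "\<sigma> run = (if \<exists>H'. good (hd run) H' then SOME H'. good (hd run) H'
    else SOME H'. H' |\<in>| options (hd run) 0)" for run
  have good: "good H (\<sigma> (H # past))" if "lwin N 0 H" for H past
  proof -
    have ex: "\<exists>H'. good H H'"
      using lwin_0D[OF that] by (simp add: good_def)
    from someI_ex[OF this] ex show ?thesis
      by (simp add: \<sigma>_def)
  qed
  have "left_strategy \<sigma>"
    unfolding left_strategy_def
  proof (intro allI impI)
    fix H :: game and past :: "game list"
    assume "options H 0 \<noteq> {||}"
    then have "\<exists>H'. H' |\<in>| options H 0" by auto
    then have "(SOME H'. H' |\<in>| options H 0) |\<in>| options H 0" by (rule someI_ex)
    moreover have "(SOME H'. good H H') |\<in>| options H 0" if "\<exists>H'. good H H'"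
      using someI_ex[OF that] by (simp add: good_def)
    ultimately show "\<sigma> (H # past) |\<in>| options H 0"
      by (simp add: \<sigma>_def)
  qed
  moreover have "\<not> loser N s run 0" if "run_with N s \<sigma> G run" for run
  proof -
    \<comment> \<open>\<open>lwin\<close> is an invariant of runs with \<open>\<sigma>\<close>, so
      Left on turn always has an option.\<close>
    from that have "lwin N (to_move N s run) (hd run)"
    proof induction
      case start
      then show ?case using assms by (simp add: to_move_def)
    next
      case (left H past)
      then show ?case using good[of H past] by (simp add: to_move_Cons good_def)
    next
      case (other H past H')
      then show ?case by (auto simp: to_move_Cons intro: lwin_otherD)
    qed
    then show ?thesis
      unfolding loser_def using lwin_0D by fastforce
  qed
  ultimately show ?thesis
    by (auto simp: left_wins_from_def)
qed

lemma left_wins_from_iff_lwin: "left_wins_from N s G \<longleftrightarrow> lwin N (s mod N) G"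
proof
  assume "left_wins_from N s G"
  then obtain \<sigma> where "left_strategy \<sigma>"
      and "\<And>run. run_with N s \<sigma> G run \<Longrightarrow> \<not> loser N s run 0"
    by (auto simp: left_wins_from_def)
  then have "lwin N (to_move N s [G]) G"
    by (intro lwin_if_never_loser) (auto intro: run_with.start)
  then show "lwin N (s mod N) G"
    by (simp add: to_move_def)
qed (rule left_wins_from_if_lwin)

text \<open>Induction along the win in \<open>X\<close>: the other players' options in
  \<open>G + X\<close> all come from \<open>X\<close>.\<close>

lemma lwin_plus_left_only:
  assumes "\<And>i. i \<noteq> 0 \<Longrightarrow> options G i = {||}" and "lwin N p X"
  shows "lwin N p (G + X)"
  using assms(2)
proof induction
  case (left H X)
  show ?case by (rule lwin.left[of "G + H"]) (use left in \<open>auto simp: options_plus\<close>)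
next
  case (other p X)
  show ?case by (rule lwin.other) (use other assms(1) in \<open>auto simp: options_plus\<close>)
qed

primrec reserve :: "nat \<Rightarrow> nat \<Rightarrow> game" where
  "reserve N 0 = 0"
| "reserve N (Suc m) = Game (\<lambda>i. if i \<in> {1..<N} then {|reserve N m|} else {||})"

lemma N_player_reserve: "N_player N (reserve N m)"
proof (induction m)
  case 0
  show ?case by (rule N_player.intros) auto
next
  case (Suc m)
  show ?case by (rule N_player.intros) (use Suc in \<open>auto split: if_splits\<close>)
qed

lemma options_reserve_0 [simp]: "options (reserve N m) 0 = {||}"
  by (cases m) auto

text \<open>Induction on \<open>G\<close>. Left can move only in \<open>G\<close> and has finitely
  many options there, so one threshold on \<open>m\<close> serves them all; the others need only
  burn the reserve between Left's turns.\<close>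

lemma not_lwin_plus_reserve:
  assumes "N_player N G" and "0 < N"
  shows "\<forall>\<^sub>F m in sequentially. \<forall>p<N. \<not> lwin N p (G + reserve N m)"
  using assms(1)
proof induction
  case (1 G)
  have "\<forall>\<^sub>F m in sequentially. \<forall>G' \<in> fset (options G 0). \<forall>p<N. \<not> lwin N p (G' + reserve N m)"
    using 1 assms(2) by (intro eventually_ball_finite) auto
  then obtain M where M: "\<And>m G' p. \<lbrakk>M \<le> m; G' |\<in>| options G 0; p < N\<rbrakk> \<Longrightarrow>
      \<not> lwin N p (G' + reserve N m)"
    by (auto simp: eventually_sequentially)
  have zero: "\<not> lwin N 0 (G + reserve N m)" if "M \<le> m" for m
    using M[OF that] assms(2) by (auto simp: options_plus dest!: lwin_0D)
  \<comment> \<open>From \<open>p > 0\<close>, \<open>N - p\<close> reserve moves bring the turn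
    round to Left and leave a reserve of at least \<open>M\<close>.\<close>
  have step: "\<not> lwin N p (G + reserve N m)" if "p < N" "M + (N - p) \<le> m" for p m
    using that
  proof (induction "N - p" arbitrary: p m)
    case 0
    then show ?case by simp
  next
    case (Suc k)
    show ?case
    proof (cases "p = 0")
      case True
      then show ?thesis using zero Suc.prems by simp
    next
      case False
      from Suc.prems obtain m' where m: "m = Suc m'" by (cases m) auto
      have "\<not> lwin N (Suc p mod N) (G + reserve N m')"
      proof (cases "Suc p < N")
        case True
        then show ?thesis using Suc m by simp
      next
        case False
        then have "Suc p = N" using Suc.prems by simp
        then show ?thesis using zero Suc.prems m by simp
      qed
      moreover have "G + reserve N m' |\<in>| options (G + reserve N m) p"
        using False Suc.prems m by (auto simp: options_plus)
      ultimately show ?thesis using False lwin_otherD by blast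
    qed
  qed
  show ?case
    unfolding eventually_sequentially using step by (intro exI[of _ "M + N"]) auto
qed

lemma not_lwin_sum_if_other_option:
  assumes "2 < N" "N_player N G" "0 < j" "j < N" "options G j \<noteq> {||}"
  obtains X where "N_player N X" "lwin N j X" "\<not> lwin N j (G + X)"
proof -
  from assms obtain G' where G': "G' |\<in>| options G j" by auto
  have NG': "N_player N G'"
    using assms(2,4) G' by (rule N_player_option)
  then have NG'': "N_player N H" if "H |\<in>| options G' 0" for H
    using N_player_option[OF NG' _ that] assms(1) by simp
  \<comment> \<open>Left's options of \<open>G'\<close> are included because Left may move once
    before the reserve is opened.\<close>
  have "\<forall>\<^sub>F m in sequentially. \<forall>H \<in> insert G' (fset (options G' 0)).
      \<forall>p<N. \<not> lwin N p (H + reserve N m)"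
    using assms(1) NG' NG'' by (intro eventually_ball_finite) (auto intro: not_lwin_plus_reserve)
  from eventually_happens'[OF sequentially_bot this] obtain m
    where m: "\<And>H p. \<lbrakk>H = G' \<or> H |\<in>| options G' 0; p < N\<rbrakk> \<Longrightarrow>
      \<not> lwin N p (H + reserve N m)"
    by auto
  define X where "X = Game (\<lambda>i. if i \<in> {1..<N} - {j} then {|reserve N m|} else {||})"
  \<comment> \<open>Player \<open>p\<close> opens the reserve by replacing \<open>X\<close> with
    \<open>reserve N m\<close>.\<close>
  have opened: "\<not> lwin N p (H + X)" if "H = G' \<or> H |\<in>| options G' 0" "0 < p" "p < N" "p \<noteq> j" for H p
  proof
    assume "lwin N p (H + X)"
    moreover have "H + reserve N m |\<in>| options (H + X) p"
      using that by (auto simp: options_plus X_def)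
    ultimately have "lwin N (Suc p mod N) (H + reserve N m)"
      using that(2) lwin_otherD by blast
    then show False using m[OF that(1)] assms(1) by simp
  qed
  \<comment> \<open>If \<open>j\<close> is not last, the next player opens the reserve. Otherwise
    Left must first move in \<open>G'\<close>, and then player 1 opens it, who differs from
    \<open>j = N - 1\<close> as \<open>N > 2\<close>.\<close>
  have "\<not> lwin N (Suc j mod N) (G' + X)"
  proof (cases "Suc j < N")
    case True
    then show ?thesis using opened by simp
  next
    case False
    then have j: "Suc j = N" using assms(4) by simp
    show ?thesis
    proof
      assume "lwin N (Suc j mod N) (G' + X)"
      then obtain H where "H |\<in>| options G' 0" "lwin N (Suc 0 mod N) (H + X)"
        using j by (auto simp: options_plus X_def dest!: lwin_0D)
      then show False using opened[of H 1] j assms(1) by simp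
    qed
  qed
  moreover have "G' + X |\<in>| options (G + X) j"
    using G' by (auto simp: options_plus)
  ultimately have "\<not> lwin N j (G + X)"
    using assms(3) lwin_otherD by blast
  moreover have "lwin N j X"
    by (rule lwin.other) (use assms(3) in \<open>auto simp: X_def\<close>)
  moreover have "N_player N X"
    by (rule N_player.intros) (auto simp: X_def N_player_reserve split: if_splits)
  ultimately show thesis using that by blast
qed

theorem mainTheorem12:
  fixes N :: nat and G :: game
  assumes "N > 2" and "N_player N G"
  shows "le_left N 0 G \<longleftrightarrow>
    (G \<cong> 0 \<or> (\<forall>i<N. i \<noteq> 0 \<longrightarrow> options G i = {||}))"
proof
  assume le: "le_left N 0 G"
  have "options G j = {||}" if j: "j < N" "0 < j" for j
  proof (rule ccontr)
    assume "options G j \<noteq> {||}"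
    then obtain X where X: "N_player N X" "lwin N j X" "\<not> lwin N j (G + X)"
      using not_lwin_sum_if_other_option[OF assms _ j(1)] j(2) by blast
    \<comment> \<open>When \<open>j\<close> starts, Left is the \<open>(N + 1 - j)\<close>th to
      move.\<close>
    have "N + 1 - j \<in> {1..N}" and "(N + 1 - (N + 1 - j)) mod N = j"
      using j by auto
    then show False
      using le X unfolding le_left_def left_wins_moving_def left_wins_from_iff_lwin
      by (metis mod_mod_trivial zero_plus_game)
  qed
  then show "G \<cong> 0 \<or> (\<forall>i<N. i \<noteq> 0 \<longrightarrow> options G i = {||})" by simp
next
  assume "G \<cong> 0 \<or> (\<forall>i<N. i \<noteq> 0 \<longrightarrow> options G i = {||})"
  \<comment> \<open>Indices from \<open>N\<close> on are covered too, since
    \<open>lwin_plus_left_only\<close> asks for all \<open>i \<noteq> 0\<close>.\<close>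
  moreover have "options G i = {||}" if "N \<le> i" for i
    using assms(2) that by (auto elim: N_player.cases)
  ultimately have "options G i = {||}" if "i \<noteq> 0" for i
    using that game_iso_zero by (metis not_le)
  then show "le_left N 0 G"
    unfolding le_left_def left_wins_moving_def left_wins_from_iff_lwin
    by (auto intro: lwin_plus_left_only)
qed

end
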